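(* There exists a twelve-element three-generated meet-distributive lattice with exactly four atoms.
   Context: A lattice $L$ is three-generated if it has a three-element subset $\{a_1,a_2,a_3\}$ that is contained in no proper sublattice of $L$ (a sublattice $S$ is proper if $S\neq L$). An element $a\in L$ is an atom if the principal ideal $\{x\in L: x\leq a\}$ has exactly two elements. A finite lattice $L$ is meet-distributive if for each $x\in L$ there is a unique minimal (with respect to set inclusion) set $Y$ of join-irreducible elements of $L$ such that $x=\bigvee\{y: y\in Y\}$ (the empty join being the least element). *)

theory Defs
  imports "HOL-Algebra.Lattice"
begin

definition sublattice :: "('a, 'b) gorder_scheme \<Rightarrow> 'a set \<Rightarrow> bool" where
  "sublattice L S \<longleftrightarrow> S \<noteq> {} \<and> S \<subseteq> carrier L \<and>
     (\<forall>x\<in>S. \<forall>y\<in>S. x \<squnion>\<^bsub>L\<^esub> y \<in> S \<and> x \<sqinter>\<^bsub>L\<^esub> y \<in> S)"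

definition three_generated :: "('a, 'b) gorder_scheme \<Rightarrow> bool" where
  "three_generated L \<longleftrightarrow>
     (\<exists>A. A \<subseteq> carrier L \<and> card A = 3 \<and>
        \<not> (\<exists>S. sublattice L S \<and> S \<noteq> carrier L \<and> A \<subseteq> S))"

definition is_atom :: "('a, 'b) gorder_scheme \<Rightarrow> 'a \<Rightarrow> bool" where
  "is_atom L a \<longleftrightarrow> a \<in> carrier L \<and> card {x \<in> carrier L. x \<sqsubseteq>\<^bsub>L\<^esub> a} = 2"

text \<open>As usual, the least element is not join-irreducible: it is the empty join.\<close>

definition join_irreducible :: "('a, 'b) gorder_scheme \<Rightarrow> 'a \<Rightarrow> bool" where
  "join_irreducible L x \<longleftrightarrow> x \<in> carrier L \<and> \<not> least L x (carrier L) \<and>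
     (\<forall>a\<in>carrier L. \<forall>b\<in>carrier L. x = a \<squnion>\<^bsub>L\<^esub> b \<longrightarrow> x = a \<or> x = b)"

text \<open>
  In a finite nonempty lattice every subset of the carrier has a least upper bound, so the
  join below is genuine, and the join of the empty set is the least element.
\<close>

definition ji_representation :: "('a, 'b) gorder_scheme \<Rightarrow> 'a \<Rightarrow> 'a set \<Rightarrow> bool" where
  "ji_representation L x Y \<longleftrightarrow> (\<forall>y\<in>Y. join_irreducible L y) \<and> x = \<Squnion>\<^bsub>L\<^esub> Y"

definition meet_distributive :: "('a, 'b) gorder_scheme \<Rightarrow> bool" where
  "meet_distributive L \<longleftrightarrow> lattice L \<and> finite (carrier L) \<and>
     (\<forall>x\<in>carrier L. \<exists>!Y. ji_representation L x Y \<and>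
        (\<forall>Z. ji_representation L x Z \<and> Z \<subseteq> Y \<longrightarrow> Z = Y))"

end

(* The lattice is that of the vertex sets of subtrees (including the empty one) of the star with
   three leaves. Its join-irreducible elements are the four single vertices. A subtree is the join
   of those of its vertices whose removal leaves a subtree, and for the same reason none of these
   can be omitted from a join representation. The three leaves generate: joining two of them and
   then intersecting two of the resulting paths yields edges, and these meet in the centre. *)

theory Submission
  imports Defs
begin

lemma finite_lattice_sup_least:
  assumes "lattice L" "finite (carrier L)" "carrier L \<noteq> {}" "Y \<subseteq> carrier L"
  shows "least L (\<Squnion>\<^bsub>L\<^esub>Y) (Upper L Y)"
proof -
  interpret lattice L by fact
  show ?thesis
  proof (cases "Y = {}")
    case True
    \<comment> \<open>Every element bounds the empty set from above, so its join is the bottom,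
      obtained here as the meet of the whole carrier.\<close>
    have "greatest L (\<Sqinter>\<^bsub>L\<^esub>carrier L) (Lower L (carrier L))"
      using assms finite_inf_greatest by blast
    then have "least L (\<Sqinter>\<^bsub>L\<^esub>carrier L) (Upper L Y)"
      unfolding True by (auto simp: least_def greatest_def Lower_def Upper_def)
    then show ?thesis
      unfolding sup_def by (rule someI)
  next
    case False
    then show ?thesis
      using assms finite_sup_least finite_subset by metis
  qed
qed

text \<open>\<open>\<Squnion>\<close> is defined by choice. Since the least upper bound exists and
  is unique, the equation for the join becomes an order condition that can be checked
  directly.\<close>

lemma ji_representation_iff_least:
  assumes "lattice L" "finite (carrier L)" "carrier L \<noteq> {}"
  shows "ji_representation L x Y \<longleftrightarrow> (\<forall>y\<in>Y. join_irreducible L y) \<and> least L x (Upper L Y)"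
proof -
  interpret lattice L by fact
  have "x = \<Squnion>\<^bsub>L\<^esub>Y \<longleftrightarrow> least L x (Upper L Y)" if "\<forall>y\<in>Y. join_irreducible L y"
  proof -
    have "Y \<subseteq> carrier L"
      using that by (auto simp: join_irreducible_def)
    then have "least L (\<Squnion>\<^bsub>L\<^esub>Y) (Upper L Y)"
      using finite_lattice_sup_least[OF assms] by blast
    then show ?thesis
      using least_unique by blast
  qed
  then show ?thesis
    unfolding ji_representation_def by blast
qed

text \<open>A representation \<open>E x\<close> contained in all others is minimal, and any minimal
  one contains \<open>E x\<close> and hence equals it.\<close>

lemma meet_distributiveI:
  assumes "lattice L" "finite (carrier L)"
    and rep: "\<And>x. x \<in> carrier L \<Longrightarrow> ji_representation L x (E x)"
    and min: "\<And>x Z. \<lbrakk>x \<in> carrier L; ji_representation L x Z\<rbrakk> \<Longrightarrow> E x \<subseteq> Z"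
  shows "meet_distributive L"
  unfolding meet_distributive_def
proof (intro conjI ballI)
  fix x assume x: "x \<in> carrier L"
  show "\<exists>!Y. ji_representation L x Y \<and> (\<forall>Z. ji_representation L x Z \<and> Z \<subseteq> Y \<longrightarrow> Z = Y)"
    using rep[OF x] min[OF x] by (intro ex1I[of _ "E x"]) blast+
qed (use assms in auto)

text \<open>A vertex set is coded by its bits; the centre is bit 0.\<close>

definition star_subtrees :: "nat set" where
  "star_subtrees = {0, 1, 2, 4, 8, 3, 5, 9, 7, 11, 13, 15}"

definition star_le :: "nat \<Rightarrow> nat \<Rightarrow> bool" where
  "star_le x y \<longleftrightarrow> and x y = x"

text \<open>Every vertex set containing the centre is a subtree, so a disconnected union is repaired
  by adding bit 0.\<close>

definition star_join :: "nat \<Rightarrow> nat \<Rightarrow> nat" where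
  "star_join x y = (if or x y \<in> star_subtrees then or x y else or 1 (or x y))"

definition star_lattice :: "nat gorder" where
  "star_lattice = \<lparr>carrier = star_subtrees, eq = (=), le = star_le\<rparr>"

text \<open>These are the extreme points of the convex geometry of subtrees. As the bit
  \<open>p\<close> is set in \<open>x\<close>, the subtraction just clears it.\<close>

definition star_extreme :: "nat \<Rightarrow> nat set" where
  "star_extreme x = {p \<in> {1, 2, 4, 8}. star_le p x \<and> x - p \<in> star_subtrees}"

lemma star_lattice_simps [simp]:
  "carrier star_lattice = star_subtrees"
  "eq star_lattice = (=)"
  "x \<sqsubseteq>\<^bsub>star_lattice\<^esub> y \<longleftrightarrow> star_le x y"
  by (simp_all add: star_lattice_def)

text \<open>Paths in a tree are unique, so the path between two common vertices lies in both
  subtrees.\<close>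

lemma star_meet_in: "\<forall>x\<in>star_subtrees. \<forall>y\<in>star_subtrees. and x y \<in> star_subtrees"
  by (simp add: star_subtrees_def star_le_def star_join_def flip: numeral_3_eq_3)

lemma star_join_in: "\<forall>x\<in>star_subtrees. \<forall>y\<in>star_subtrees. star_join x y \<in> star_subtrees"
  by (simp add: star_subtrees_def star_le_def star_join_def flip: numeral_3_eq_3)

lemma star_join_upper:
  "\<forall>x\<in>star_subtrees. \<forall>y\<in>star_subtrees. star_le x (star_join x y) \<and> star_le y (star_join x y)"
  by (simp add: star_subtrees_def star_le_def star_join_def flip: numeral_3_eq_3)

text \<open>If the union is not a subtree, it contains two leaves, and any subtree containing both
  contains the centre.\<close>

lemma star_join_least:
  "\<forall>x\<in>star_subtrees. \<forall>y\<in>star_subtrees. \<forall>z\<in>star_subtrees.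
     star_le x z \<longrightarrow> star_le y z \<longrightarrow> star_le (star_join x y) z"
  by (simp add: star_subtrees_def star_le_def star_join_def flip: numeral_3_eq_3)

text \<open>A subtree with at least two vertices contains the centre and some leaf, and is the join
  of that leaf and the rest. Below a single vertex there is only the empty subtree.\<close>

lemma star_join_irreducible_iff:
  "\<forall>x\<in>star_subtrees. x \<noteq> 0 \<and>
     (\<forall>a\<in>star_subtrees. \<forall>b\<in>star_subtrees. x = star_join a b \<longrightarrow> x = a \<or> x = b)
     \<longleftrightarrow> x \<in> {1, 2, 4, 8}"
  by (simp add: star_subtrees_def star_le_def star_join_def flip: numeral_3_eq_3)

text \<open>In a single vertex or an edge all vertices are extreme. In a larger subtree the leaves
  are, and the centre lies between any two of them.\<close>

lemma star_extreme_least: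
  "\<forall>x\<in>star_subtrees. (\<forall>p\<in>star_extreme x. star_le p x) \<and>
     (\<forall>z\<in>star_subtrees. (\<forall>p\<in>star_extreme x. star_le p z) \<longrightarrow> star_le x z)"
  by code_simp

text \<open>The subtree \<open>x - p\<close> serves as \<open>z\<close>: it loses only the vertex
  \<open>p\<close>.\<close>

lemma star_extreme_needed:
  "\<forall>x\<in>star_subtrees. \<forall>p\<in>star_extreme x. \<exists>z\<in>star_subtrees. \<not> star_le x z \<and>
     (\<forall>j\<in>{1, 2, 4, 8}. star_le j x \<longrightarrow> j \<noteq> p \<longrightarrow> star_le j z)"
  by code_simp

text \<open>\<open>Set.filter\<close> makes the down-set computable by evaluation.\<close>

lemma star_down_set_card:
  "\<forall>x\<in>star_subtrees. card (Set.filter (\<lambda>y. star_le y x) star_subtrees) = 2 \<longleftrightarrow> x \<in> {1, 2, 4, 8}"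
  by code_simp

lemma star_le_refl: "star_le x x"
  by (simp add: star_le_def)

lemma star_le_antisym: "star_le x y \<Longrightarrow> star_le y x \<Longrightarrow> x = y"
  by (simp add: star_le_def and.commute)

lemma star_le_trans: "star_le x y \<Longrightarrow> star_le y z \<Longrightarrow> star_le x z"
  unfolding star_le_def by (metis and.assoc)

lemma star_meet_greatest:
  "star_le (and x y) x" "star_le (and x y) y"
  "star_le z x \<Longrightarrow> star_le z y \<Longrightarrow> star_le z (and x y)"
  unfolding star_le_def by (simp_all add: ac_simps)

lemma star_least_join:
  assumes "x \<in> star_subtrees" "y \<in> star_subtrees"
  shows "least star_lattice (star_join x y) (Upper star_lattice {x, y})"
  using assms star_join_in star_join_upper star_join_least
  by (auto simp: least_def Upper_def)

lemma star_greatest_meet: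
  assumes "x \<in> star_subtrees" "y \<in> star_subtrees"
  shows "greatest star_lattice (and x y) (Lower star_lattice {x, y})"
  using assms star_meet_in star_meet_greatest
  by (auto simp: greatest_def Lower_def)

lemma lattice_star_lattice: "lattice star_lattice"
proof
  fix x y assume "x \<in> carrier star_lattice" "y \<in> carrier star_lattice"
  then have xy: "x \<in> star_subtrees" "y \<in> star_subtrees"
    by simp_all
  show "\<exists>s. least star_lattice s (Upper star_lattice {x, y})"
    using star_least_join[OF xy] by blast
  show "\<exists>s. greatest star_lattice s (Lower star_lattice {x, y})"
    using star_greatest_meet[OF xy] by blast
qed (auto intro: star_le_refl star_le_antisym star_le_trans)

interpretation star: lattice star_lattice
  by (rule lattice_star_lattice)

lemma star_join_eq:
  assumes "x \<in> star_subtrees" "y \<in> star_subtrees"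
  shows "x \<squnion>\<^bsub>star_lattice\<^esub> y = star_join x y"
  using star_least_join[OF assms] star.sup_of_two_least[of x y] assms
  by (auto simp: join_def intro: star.least_unique)

lemma star_meet_eq:
  assumes "x \<in> star_subtrees" "y \<in> star_subtrees"
  shows "x \<sqinter>\<^bsub>star_lattice\<^esub> y = and x y"
  using star_greatest_meet[OF assms] star.inf_of_two_greatest[of x y] assms
  by (auto simp: meet_def intro: star.greatest_unique)

lemma finite_star_subtrees: "finite star_subtrees"
  by (simp add: star_subtrees_def)

lemma join_irreducible_star_iff: "join_irreducible star_lattice x \<longleftrightarrow> x \<in> {1, 2, 4, 8}"
proof -
  have bot: "least star_lattice x star_subtrees \<longleftrightarrow> x = 0"
  proof
    assume "least star_lattice x star_subtrees"
    then show "x = 0"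
      by (auto simp: least_def star_subtrees_def star_le_def)
  qed (auto simp: least_def star_subtrees_def star_le_def)
  have "{1, 2, 4, 8} \<subseteq> star_subtrees"
    by (simp add: star_subtrees_def)
  then show ?thesis
    using star_join_irreducible_iff
    by (auto simp: join_irreducible_def bot star_join_eq)
qed

lemma ji_representation_star_iff:
  "ji_representation star_lattice x Y \<longleftrightarrow>
     Y \<subseteq> {1, 2, 4, 8} \<and> least star_lattice x (Upper star_lattice Y)"
  using ji_representation_iff_least[OF lattice_star_lattice, of x Y] finite_star_subtrees
  by (auto simp: join_irreducible_star_iff subset_iff star_subtrees_def)

lemma meet_distributive_star_lattice: "meet_distributive star_lattice"
proof (rule meet_distributiveI[where E = star_extreme])
  fix x assume "x \<in> carrier star_lattice"
  then have x: "x \<in> star_subtrees" by simp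
  have "star_extreme x \<subseteq> star_subtrees"
    by (auto simp: star_extreme_def star_subtrees_def)
  then have "least star_lattice x (Upper star_lattice (star_extreme x))"
    using x star_extreme_least by (auto simp: least_def Upper_def subset_iff)
  then show "ji_representation star_lattice x (star_extreme x)"
    by (auto simp: ji_representation_star_iff star_extreme_def)
  fix Z assume "ji_representation star_lattice x Z"
  then have Z: "Z \<subseteq> {1, 2, 4, 8}" and least: "least star_lattice x (Upper star_lattice Z)"
    by (auto simp: ji_representation_star_iff)
  show "star_extreme x \<subseteq> Z"
  proof (rule subsetI, rule ccontr)
    \<comment> \<open>All members of \<open>Z\<close> are vertices of \<open>x\<close> other than
      \<open>p\<close>, so \<open>z\<close> is an upper bound of \<open>Z\<close> not above
      \<open>x\<close>, against leastness.\<close>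
    fix p assume "p \<in> star_extreme x" "p \<notin> Z"
    then obtain z where z: "z \<in> star_subtrees" "\<not> star_le x z"
      "\<And>j. j \<in> {1, 2, 4, 8} \<Longrightarrow> star_le j x \<Longrightarrow> j \<noteq> p \<Longrightarrow> star_le j z"
      using x star_extreme_needed by meson
    have ZC: "Z \<subseteq> star_subtrees"
      using Z by (auto simp: star_subtrees_def)
    have "star_le j x" if "j \<in> Z" for j
      using least that ZC by (auto simp: least_def Upper_def)
    then have "star_le j z" if "j \<in> Z" for j
      using z(3)[of j] Z \<open>p \<notin> Z\<close> that by blast
    then have "z \<in> Upper star_lattice Z"
      using z(1) by (simp add: Upper_def)
    with least z show False
      by (auto simp: least_def)
  qed
qed (use lattice_star_lattice finite_star_subtrees in auto)

lemma three_generated_star_lattice: "three_generated star_lattice"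
proof -
  have "S = star_subtrees" if S: "sublattice star_lattice S" "{2, 4, 8} \<subseteq> S" for S
  proof
    show "S \<subseteq> star_subtrees"
      using S by (simp add: sublattice_def)
    have join: "star_join x y \<in> S" and meet: "and x y \<in> S" if "x \<in> S" "y \<in> S" for x y
      using S \<open>S \<subseteq> star_subtrees\<close> that star_join_eq star_meet_eq
      unfolding sublattice_def by (metis subsetD)+
    have s: "2 \<in> S" "4 \<in> S" "8 \<in> S"
      using S by auto
    \<comment> \<open>These code the three paths between leaves; the edges 3, 5, 9 below are their
      pairwise intersections.\<close>
    have j: "7 \<in> S" "11 \<in> S" "13 \<in> S"
      using join[OF s(1,2)] join[OF s(1,3)] join[OF s(2,3)]
      by (simp_all add: star_join_def star_subtrees_def)
    have m: "0 \<in> S" "3 \<in> S" "5 \<in> S" "9 \<in> S"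
      using meet[OF s(1,2)] meet[OF j(1,2)] meet[OF j(1,3)] meet[OF j(2,3)]
      by (simp_all flip: numeral_3_eq_3)
    have "1 \<in> S" "15 \<in> S"
      using meet[OF m(2,3)] join[OF j(1) s(3)]
      by (simp_all add: star_join_def star_subtrees_def)
    with s j m show "star_subtrees \<subseteq> S"
      by (simp add: star_subtrees_def)
  qed
  then show ?thesis
    unfolding three_generated_def
    by (intro exI[of _ "{2, 4, 8}"]) (auto simp: star_subtrees_def)
qed

lemma atoms_star_lattice: "{a. is_atom star_lattice a} = {1, 2, 4, 8}"
proof -
  have "{1, 2, 4, 8} \<subseteq> star_subtrees"
    by (simp add: star_subtrees_def)
  then show ?thesis
    using star_down_set_card by (auto simp: is_atom_def)
qed

theorem mainTheorem3:
  shows "\<exists>L :: nat gorder. lattice L \<and> card (carrier L) = 12 \<and> three_generated L \<and>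
           meet_distributive L \<and> card {a. is_atom L a} = 4"
proof (intro exI conjI)
  show "card (carrier star_lattice) = 12"
    by (simp add: star_subtrees_def)
  show "card {a. is_atom star_lattice a} = 4"
    by (simp add: atoms_star_lattice)
qed (fact lattice_star_lattice three_generated_star_lattice meet_distributive_star_lattice)+

end
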